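(* Let $q\ge2$, $n\ge0$ be integers, let $G=(g_{ij})_{i,j=0}^{q-1}$ be a $q\times q$ generalized Hadamard matrix, and let $\gamma$ be a polynomial evaluated at $x=(x_0,\ldots,x_{q-1})\in V(n,q)$. (1) Suppose $G$ is symmetric. If $\gamma(x)=\sum_{s\in V(n,q)}\alpha_s\,MG(x;s)$ for all $x\in V(n,q)$ with coefficients $\alpha_s\in\mathbb{C}$, then for all $\ell\in V(n,q)$, \[ \alpha_\ell=q^{-n}\sum_{i\in V(n,q)}\gamma(i)\,\overline{MG(\ell;i)}. \] If $\gamma(x)=\sum_{s\in V(n,q)}\beta_s\,MG(s;x)$ for all $x\in V(n,q)$ with coefficients $\beta_s\in\mathbb{C}$, then for all $\ell\in V(n,q)$, \[ \beta_\ell=q^{-n}\sum_{i\in V(n,q)}\gamma(i)\,\overline{MG(i;\ell)}. \] (2) Suppose instead that the core of $G$ is symmetric, $g_{0,j}=1$ for $j=0,\ldots,q-1$ and $g_{i,0}=-1$ for $i=1,\ldots,q-1$. Then, with the expansions as in (1), for all $\ell\in V(n,q)$, \[ \alpha_\ell=(-1)^{\ell_0}q^{-n}\sum_{i\in V(n,q)}(-1)^{i_0}\gamma(i)\,\overline{MG(\ell;i)},\qquad \beta_\ell=(-1)^{\ell_0}q^{-n}\sum_{i\in V(n,q)}(-1)^{i_0}\gamma(i)\,\overline{MG(i;\ell)}. \]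
   Context: A $q\times q$ complex matrix $H$ is a generalized Hadamard matrix if $H\overline{H}^T=qI_q$. The core of $G$ is the matrix $(g_{ij})_{i,j=1}^{q-1}$ obtained by deleting the first row and first column. For integers $n\ge0$, $q\ge2$, $V(n,q)=\{p=(p_0,\ldots,p_{q-1})\in\mathbb{N}_0^q : \sum_i p_i=n\}$, and $p!=\prod_{i}p_i!$. For $p,s\in V(n,q)$, \[ MG(p;s)=s!\sum_{(r_{i,j})}\prod_{a=0}^{q-1}\prod_{b=0}^{q-1}\frac{g_{ab}^{r_{a,b}}}{r_{a,b}!}, \] the sum being over all families of nonnegative integers $r_{i,j}$ ($i,j=0,\ldots,q-1$) with $\sum_j r_{i,j}=s_i$ for all $i$ and $\sum_i r_{i,j}=p_j$ for all $j$ (with $0^0=1$). *)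

theory Defs
  imports
    "Jordan_Normal_Form.Matrix"
    "Jordan_Normal_Form.Determinant"
    "HOL-Library.Poly_Mapping"
begin

text \<open>Tuples indexed by \<open>0, \<dots>, q - 1\<close> are vectors of dimension \<open>q\<close>, and families \<open>r\<^sub>i\<^sub>j\<close> with
  \<open>i, j < q\<close> are \<open>q \<times> q\<close> matrices; both are indexed from 0.\<close>

text \<open>No condition on the moduli of the entries is imposed.\<close>

definition generalized_hadamard :: "nat \<Rightarrow> complex mat \<Rightarrow> bool" where
  "generalized_hadamard q H \<longleftrightarrow>
     H \<in> carrier_mat q q \<and> H * transpose_mat (map_mat cnj H) = of_nat q \<cdot>\<^sub>m 1\<^sub>m q"

definition symmetric_matrix :: "'a mat \<Rightarrow> bool" where
  "symmetric_matrix A \<longleftrightarrow> transpose_mat A = A"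

definition core :: "'a mat \<Rightarrow> 'a mat" where
  "core G = mat_delete G 0 0"

definition V :: "nat \<Rightarrow> nat \<Rightarrow> nat vec set" where
  "V n q = {p \<in> carrier_vec q. (\<Sum>i<q. p $ i) = n}"

definition vec_fact :: "nat vec \<Rightarrow> nat" where
  "vec_fact p = (\<Prod>i<dim_vec p. fact (p $ i))"

definition contingency_tables :: "nat \<Rightarrow> nat vec \<Rightarrow> nat vec \<Rightarrow> nat mat set" where
  "contingency_tables q p s = {r \<in> carrier_mat q q.
     (\<forall>i<q. (\<Sum>j<q. r $$ (i, j)) = s $ i) \<and> (\<forall>j<q. (\<Sum>i<q. r $$ (i, j)) = p $ j)}"

text \<open>The size \<open>q\<close> is read off from \<open>G\<close>.\<close>

definition MG :: "complex mat \<Rightarrow> nat vec \<Rightarrow> nat vec \<Rightarrow> complex" where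
  "MG G p s = of_nat (vec_fact s) *
     (\<Sum>r\<in>contingency_tables (dim_row G) p s.
        \<Prod>a<dim_row G. \<Prod>b<dim_row G. (G $$ (a, b)) ^ (r $$ (a, b)) / fact (r $$ (a, b)))"

text \<open>A multivariate polynomial is a finitely supported map from monomials (exponents, themselves
  finitely supported) to complex coefficients; the variables are \<open>x\<^sub>0, x\<^sub>1, \<dots>\<close>.\<close>

type_synonym cmpoly = "(nat \<Rightarrow>\<^sub>0 nat) \<Rightarrow>\<^sub>0 complex"

definition poly_in_vars :: "nat \<Rightarrow> cmpoly \<Rightarrow> bool" where
  "poly_in_vars q P \<longleftrightarrow> (\<forall>m \<in> Poly_Mapping.keys P. Poly_Mapping.keys m \<subseteq> {..<q})"

definition eval_at :: "cmpoly \<Rightarrow> nat vec \<Rightarrow> complex" where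
  "eval_at P x = (\<Sum>m \<in> Poly_Mapping.keys P.
     Poly_Mapping.lookup P m *
       (\<Prod>i \<in> Poly_Mapping.keys m. of_nat (x $ i) ^ Poly_Mapping.lookup m i))"

end

theory Submission
  imports Defs
begin

text \<open>\<open>MG G p s\<close> is the coefficient of \<open>z\<^sup>p\<close> in \<open>\<Prod>\<^sub>a (\<Sum>\<^sub>b g\<^sub>a\<^sub>b z\<^sub>b)^s\<^sub>a\<close>, so the
  arrays \<open>MG G\<close> represent linear substitutions and \<open>MG G \<cdot> MG H = MG (H G)\<close> on \<open>V n q\<close>.
  Hence the conjugate transpose of \<open>G\<close> inverts \<open>MG G\<close> up to the factor \<open>q\<^sup>n\<close>. Under either
  hypothesis that conjugate transpose is the entrywise conjugate of \<open>G\<close>, up to changing the signs of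
  row 0 and column 0.
  Instead of polynomials, the product formula uses the recursion that splits off one linear factor.\<close>

section \<open>Tuples of given sum and the removal of one unit\<close>

lemma V_D:
  assumes "p \<in> V n q"
  shows "p \<in> carrier_vec q" "dim_vec p = q" "(\<Sum>i<q. p $ i) = n"
  using assms by (auto simp: V_def)

lemma finite_V: "finite (V n q)"
proof (rule finite_subset)
  show "V n q \<subseteq> vec q ` (PiE {..<q} (\<lambda>_. {..n}))"
  proof
    fix p assume p: "p \<in> V n q"
    have "p = vec q (restrict (\<lambda>i. p $ i) {..<q})"
      using V_D(2)[OF p] by (intro eq_vecI) auto
    moreover have "p $ i \<le> n" if "i < q" for i
      using member_le_sum[of i "{..<q}" "\<lambda>i. p $ i"] that V_D(3)[OF p] by auto
    then have "restrict (\<lambda>i. p $ i) {..<q} \<in> PiE {..<q} (\<lambda>_. {..n})" by auto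
    ultimately show "p \<in> vec q ` (PiE {..<q} (\<lambda>_. {..n}))" by blast
  qed
qed (intro finite_imageI finite_PiE, auto)

lemma V_0: "V 0 q = {0\<^sub>v q}"
  by (auto simp: V_def intro!: eq_vecI)

lemma add_unit_vec_in_V:
  assumes "s \<in> V n q" "b < q"
  shows "s + unit_vec q b \<in> V (Suc n) q"
proof -
  have "(\<Sum>i<q. (s + unit_vec q b) $ i) = (\<Sum>i<q. s $ i) + (\<Sum>i<q. if i = b then 1 else 0)"
    unfolding sum.distrib[symmetric] using assms V_D(2)[OF assms(1)]
    by (intro sum.cong) (auto simp: unit_vec_def)
  then show ?thesis using assms by (auto simp: V_def)
qed

lemma add_diff_unit_vec:
  fixes s :: "nat vec"
  assumes "dim_vec s = q" "b < q" "s $ b > 0"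
  shows "s - unit_vec q b + unit_vec q b = s"
  using assms by (intro eq_vecI) (auto simp: unit_vec_def)

lemma diff_add_unit_vec:
  fixes s :: "nat vec"
  assumes "dim_vec s = q" "b < q"
  shows "s + unit_vec q b - unit_vec q b = s"
  using assms by (intro eq_vecI) (auto simp: unit_vec_def)

lemma diff_unit_vec_in_V:
  assumes "s \<in> V (Suc n) q" "b < q" "s $ b > 0"
  shows "s - unit_vec q b \<in> V n q"
proof -
  \<comment> \<open>The sum of the difference is left unevaluated: adding the unit back and
    comparing totals identifies it as \<open>n\<close>, with no sum of truncated differences to
    compute.\<close>
  have "s - unit_vec q b \<in> V (\<Sum>i<q. (s - unit_vec q b) $ i) q"
    using V_D(1)[OF assms(1)] by (auto simp: V_def)
  from add_unit_vec_in_V[OF this assms(2)] have "s \<in> V (Suc (\<Sum>i<q. (s - unit_vec q b) $ i)) q"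
    using add_diff_unit_vec V_D(2)[OF assms(1)] assms by simp
  then show ?thesis
    using \<open>s - unit_vec q b \<in> V _ q\<close> assms(1) by (auto simp: V_def)
qed

lemma V_Suc_obtain:
  assumes "t \<in> V (Suc n) q"
  obtains a t' where "a < q" "t' \<in> V n q" "t = t' + unit_vec q a"
proof -
  have "(\<Sum>i<q. t $ i) \<noteq> 0" using assms by (auto simp: V_def)
  then obtain a where "a < q" "t $ a > 0" by auto
  with that[of a "t - unit_vec q a"] show ?thesis
    using assms diff_unit_vec_in_V add_diff_unit_vec V_D(2) by metis
qed

text \<open>Adding a unit at \<open>b\<close> is a bijection from \<open>V n q\<close> onto the
  tuples of \<open>V (Suc n) q\<close> that are positive at \<open>b\<close>. The conditional on the
  left has the form in which the recursion for \<open>MG\<close> delivers its terms.\<close>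

lemma sum_V_Suc:
  fixes f :: "nat vec \<Rightarrow> 'a::comm_monoid_add"
  assumes "b < q"
  shows "(\<Sum>s\<in>V (Suc n) q. if s $ b = 0 then 0 else f s) = (\<Sum>s\<in>V n q. f (s + unit_vec q b))"
proof -
  have "(\<Sum>s\<in>V (Suc n) q. if s $ b = 0 then 0 else f s) = (\<Sum>s\<in>{s\<in>V (Suc n) q. s $ b > 0}. f s)"
    by (intro sum.mono_neutral_cong_right finite_V) auto
  also have "\<dots> = (\<Sum>s\<in>V n q. f (s + unit_vec q b))"
    by (rule sum.reindex_bij_witness[of _ "\<lambda>s. s + unit_vec q b" "\<lambda>s. s - unit_vec q b"])
       (use assms in \<open>auto simp: add_diff_unit_vec diff_add_unit_vec diff_unit_vec_in_V
          add_unit_vec_in_V V_D(2)\<close>)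
  finally show ?thesis .
qed

lemma vec_fact_add_unit_vec:
  assumes "dim_vec s = q" "a < q"
  shows "vec_fact (s + unit_vec q a) = Suc (s $ a) * vec_fact s"
proof -
  have "(\<Prod>i\<in>{..<q} - {a}. fact ((s + unit_vec q a) $ i)) = (\<Prod>i\<in>{..<q} - {a}. fact (s $ i) :: nat)"
    using assms by (intro prod.cong) (auto simp: unit_vec_def)
  then show ?thesis using assms
    by (simp add: vec_fact_def prod.remove[of "{..<q}" a] algebra_simps)
qed

section \<open>Contingency tables and the removal of one unit\<close>

lemma finite_contingency_tables: "finite (contingency_tables q p s)"
proof (rule finite_subset)
  let ?F = "PiE ({..<q} \<times> {..<q}) (\<lambda>(i, j). {..s $ i})"
  show "contingency_tables q p s \<subseteq> mat q q ` ?F"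
  proof
    fix r assume r: "r \<in> contingency_tables q p s"
    have "r = mat q q (restrict (\<lambda>ij. r $$ ij) ({..<q} \<times> {..<q}))"
      using r by (intro eq_matI) (auto simp: contingency_tables_def)
    moreover have "r $$ (i, j) \<le> s $ i" if "i < q" "j < q" for i j
      using member_le_sum[of j "{..<q}" "\<lambda>j. r $$ (i, j)"] that r
      by (auto simp: contingency_tables_def)
    then have "restrict (\<lambda>ij. r $$ ij) ({..<q} \<times> {..<q}) \<in> ?F" by auto
    ultimately show "r \<in> mat q q ` ?F" by blast
  qed
qed (intro finite_imageI finite_PiE, auto)

definition unit_mat :: "nat \<Rightarrow> nat \<Rightarrow> nat \<Rightarrow> nat mat" where
  "unit_mat q a b = mat q q (\<lambda>(i, j). if i = a \<and> j = b then 1 else 0)"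

lemma add_unit_mat_in_contingency_tables:
  assumes "r \<in> contingency_tables q p s" "dim_vec p = q" "dim_vec s = q" "a < q" "b < q"
  shows "r + unit_mat q a b \<in> contingency_tables q (p + unit_vec q b) (s + unit_vec q a)"
proof -
  have e: "(r + unit_mat q a b) $$ (i, j) = r $$ (i, j) + (if i = a \<and> j = b then 1 else 0)"
    if "i < q" "j < q" for i j
    using assms that by (auto simp: contingency_tables_def unit_mat_def)
  have "(\<Sum>j<q. (r + unit_mat q a b) $$ (i, j)) = (s + unit_vec q a) $ i" if "i < q" for i
    using that assms by (cases "i = a") (simp_all add: e sum.distrib contingency_tables_def)
  moreover have "(\<Sum>i<q. (r + unit_mat q a b) $$ (i, j)) = (p + unit_vec q b) $ j" if "j < q" for j
    using that assms by (cases "j = b") (simp_all add: e sum.distrib contingency_tables_def)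
  ultimately show ?thesis
    using assms by (auto simp: contingency_tables_def unit_mat_def)
qed

lemma diff_unit_mat_in_contingency_tables:
  assumes r: "r \<in> contingency_tables q (p + unit_vec q b) (s + unit_vec q a)"
    and "dim_vec p = q" "dim_vec s = q" "a < q" "b < q" "r $$ (a, b) > 0"
  shows "r - unit_mat q a b \<in> contingency_tables q p s" (is "?r \<in> _")
    and "r - unit_mat q a b + unit_mat q a b = r"
proof -
  have c: "r \<in> carrier_mat q q"
    and rs: "\<And>i. i < q \<Longrightarrow> (\<Sum>j<q. r $$ (i, j)) = (s + unit_vec q a) $ i"
    and cs: "\<And>j. j < q \<Longrightarrow> (\<Sum>i<q. r $$ (i, j)) = (p + unit_vec q b) $ j"
    using r by (auto simp: contingency_tables_def)
  define R where "R = ?r"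
  show "?r + unit_mat q a b = r"
    using c assms(4-6) by (intro eq_matI) (auto simp: unit_mat_def)
  have R: "R \<in> carrier_mat q q"
    unfolding R_def unit_mat_def by (intro minus_carrier_mat) simp
  \<comment> \<open>Positivity of the entry at \<open>(a, b)\<close> makes the truncated subtraction
    exact. Writing \<open>r\<close> as \<open>R\<close> plus an indicator then makes the row and
    column sums additive.\<close>
  have e: "r $$ (i, j) = R $$ (i, j) + (if i = a \<and> j = b then 1 else 0)"
    if "i < q" "j < q" for i j
    using c assms(4-6) that by (auto simp: R_def unit_mat_def)
  have "(\<Sum>j<q. R $$ (i, j)) = s $ i" if "i < q" for i
    using rs[OF that] that assms(2-5)
    by (cases "i = a") (simp_all add: e sum.distrib)
  moreover have "(\<Sum>i<q. R $$ (i, j)) = p $ j" if "j < q" for j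
    using cs[OF that] that assms(2-5)
    by (cases "j = b") (simp_all add: e sum.distrib)
  ultimately show "?r \<in> contingency_tables q p s"
    using R unfolding R_def[symmetric] by (auto simp: contingency_tables_def)
qed

section \<open>Weights of tables and the recursion for \<open>MG\<close>\<close>

definition table_weight :: "complex mat \<Rightarrow> nat mat \<Rightarrow> complex" where
  "table_weight G r = (\<Prod>a<dim_row G. \<Prod>b<dim_row G. (G $$ (a, b)) ^ (r $$ (a, b)) / fact (r $$ (a, b)))"

lemma MG_table_weight:
  assumes "G \<in> carrier_mat q q"
  shows "MG G p s = of_nat (vec_fact s) * (\<Sum>r\<in>contingency_tables q p s. table_weight G r)"
  using assms by (simp add: MG_def table_weight_def)

text \<open>Only the factor at \<open>(a, b)\<close> changes. There the new exponent
  \<open>k + 1\<close> cancels against \<open>(k + 1)!\<close>, and one power of the matrix entry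
  splits off.\<close>

lemma table_weight_add_unit_mat:
  assumes "G \<in> carrier_mat q q" "r \<in> carrier_mat q q" "a < q" "b < q"
  shows "of_nat ((r + unit_mat q a b) $$ (a, b)) * table_weight G (r + unit_mat q a b)
    = G $$ (a, b) * table_weight G r"
proof -
  let ?f = "\<lambda>r x. (G $$ x) ^ (r $$ x) / (fact (r $$ x) :: complex)"
  have w: "table_weight G r = ?f r (a, b) * (\<Prod>x\<in>{..<q} \<times> {..<q} - {(a, b)}. ?f r x)" for r
    using assms
    by (subst prod.remove[symmetric]) (auto simp: table_weight_def prod.cartesian_product)
  have others: "(\<Prod>x\<in>{..<q} \<times> {..<q} - {(a, b)}. ?f (r + unit_mat q a b) x)
      = (\<Prod>x\<in>{..<q} \<times> {..<q} - {(a, b)}. ?f r x)"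
    using assms by (intro prod.cong) (auto simp: unit_mat_def split: if_splits)
  have entry: "(r + unit_mat q a b) $$ (a, b) = Suc (r $$ (a, b))"
    using assms by (auto simp: unit_mat_def)
  have absorb: "of_nat (Suc k) * (x ^ Suc k / fact (Suc k)) = x * (x ^ k / fact k)"
    for k and x :: complex
    by (simp add: field_simps del: of_nat_Suc)
  show ?thesis
    unfolding w others entry mult.assoc[symmetric] absorb ..
qed

text \<open>The factor \<open>r $$ (a, b)\<close> kills the tables with a zero at
  \<open>(a, b)\<close>; every other table loses one unit there, and the factor is absorbed by the
  factorial. The case \<open>p $ b = 0\<close> needs its own value: column \<open>b\<close> then
  vanishes, whereas truncated subtraction would leave \<open>p - unit_vec q b\<close> equal to
  \<open>p\<close>.\<close>

lemma sum_entry_table_weight: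
  assumes "G \<in> carrier_mat q q" "dim_vec p = q" "dim_vec s = q" "a < q" "b < q"
  shows "(\<Sum>r\<in>contingency_tables q p (s + unit_vec q a). of_nat (r $$ (a, b)) * table_weight G r)
    = (if p $ b = 0 then 0
       else G $$ (a, b) * (\<Sum>r\<in>contingency_tables q (p - unit_vec q b) s. table_weight G r))"
    (is "?L = ?R")
proof (cases "p $ b = 0")
  case True
  have "r $$ (a, b) = 0" if "r \<in> contingency_tables q p (s + unit_vec q a)" for r
  proof -
    have "(\<Sum>i<q. r $$ (i, b)) = 0" using that True assms by (auto simp: contingency_tables_def)
    then show ?thesis using assms by auto
  qed
  then show ?thesis using True by simp
next
  case False
  define p' where "p' = p - unit_vec q b"
  have p: "p = p' + unit_vec q b" and d: "dim_vec p' = q"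
    unfolding p'_def using False assms by (auto simp: add_diff_unit_vec)
  have "?L = (\<Sum>r\<in>{r\<in>contingency_tables q p (s + unit_vec q a). r $$ (a, b) > 0}.
      of_nat (r $$ (a, b)) * table_weight G r)"
    by (intro sum.mono_neutral_right finite_contingency_tables) auto
  also have "\<dots> = (\<Sum>r\<in>contingency_tables q p' s. G $$ (a, b) * table_weight G r)"
  proof (rule sum.reindex_bij_witness[of _ "\<lambda>r. r + unit_mat q a b" "\<lambda>r. r - unit_mat q a b"])
    fix r assume "r \<in> {r\<in>contingency_tables q p (s + unit_vec q a). r $$ (a, b) > 0}"
    then have r: "r \<in> contingency_tables q (p' + unit_vec q b) (s + unit_vec q a)" "r $$ (a, b) > 0"
      by (auto simp: p)
    note D = diff_unit_mat_in_contingency_tables[OF r(1) d assms(3-5) r(2)]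
    show "r - unit_mat q a b + unit_mat q a b = r" "r - unit_mat q a b \<in> contingency_tables q p' s"
      using D by auto
    have "r - unit_mat q a b \<in> carrier_mat q q" using D(1) by (auto simp: contingency_tables_def)
    from table_weight_add_unit_mat[OF assms(1) this assms(4,5)]
    show "G $$ (a, b) * table_weight G (r - unit_mat q a b)
        = of_nat (r $$ (a, b)) * table_weight G r"
      unfolding D(2) by simp
  next
    fix r assume r: "r \<in> contingency_tables q p' s"
    show "r + unit_mat q a b - unit_mat q a b = r"
      using r by (intro eq_matI) (auto simp: contingency_tables_def unit_mat_def)
    show "r + unit_mat q a b \<in> {r\<in>contingency_tables q p (s + unit_vec q a). r $$ (a, b) > 0}"
      using add_unit_mat_in_contingency_tables[OF r d assms(3-5)] r assms(4,5)
      by (auto simp: p contingency_tables_def unit_mat_def)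
  qed
  finally show ?thesis using False by (simp add: p'_def sum_distrib_left)
qed

text \<open>Expands one factor of row \<open>a\<close> in the generating polynomial. On tables it rests on the row sum
  \<open>s\<^sub>a + 1 = \<Sum>\<^sub>b r\<^sub>a\<^sub>b\<close>.\<close>

lemma MG_add_unit_vec:
  assumes "G \<in> carrier_mat q q" "dim_vec p = q" "dim_vec s = q" "a < q"
  shows "MG G p (s + unit_vec q a)
    = (\<Sum>b<q. if p $ b = 0 then 0 else G $$ (a, b) * MG G (p - unit_vec q b) s)"
proof -
  let ?T = "contingency_tables q p (s + unit_vec q a)"
  have row: "(of_nat (Suc (s $ a)) :: complex) = (\<Sum>b<q. of_nat (r $$ (a, b)))" if "r \<in> ?T" for r
  proof -
    have "Suc (s $ a) = (\<Sum>b<q. r $$ (a, b))"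
      using that assms by (auto simp: contingency_tables_def)
    then show ?thesis by (metis of_nat_sum)
  qed
  \<comment> \<open>The factor \<open>Suc (s $ a)\<close> comes from the factorial of
    \<open>s + unit_vec q a\<close>; inside the sum it can be replaced by the row sum of each
    table.\<close>
  have "MG G p (s + unit_vec q a)
      = of_nat (vec_fact s) * (\<Sum>r\<in>?T. of_nat (Suc (s $ a)) * table_weight G r)"
    unfolding MG_table_weight[OF assms(1)] vec_fact_add_unit_vec[OF assms(3,4)] sum_distrib_left[symmetric]
    by (simp only: of_nat_mult mult_ac)
  also have "(\<Sum>r\<in>?T. of_nat (Suc (s $ a)) * table_weight G r)
      = (\<Sum>r\<in>?T. \<Sum>b<q. of_nat (r $$ (a, b)) * table_weight G r)"
    by (intro sum.cong refl) (simp only: row sum_distrib_right)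
  also have "\<dots> = (\<Sum>b<q. \<Sum>r\<in>?T. of_nat (r $$ (a, b)) * table_weight G r)"
    by (rule sum.swap)
  also have "\<dots> = (\<Sum>b<q. if p $ b = 0 then 0
       else G $$ (a, b) * (\<Sum>r\<in>contingency_tables q (p - unit_vec q b) s. table_weight G r))"
    using assms by (intro sum.cong refl sum_entry_table_weight) auto
  also have "of_nat (vec_fact s) * \<dots>
      = (\<Sum>b<q. if p $ b = 0 then 0 else G $$ (a, b) * MG G (p - unit_vec q b) s)"
    by (subst sum_distrib_left, intro sum.cong refl) (auto simp: MG_table_weight[OF assms(1)])
  finally show ?thesis .
qed

section \<open>Products of the arrays and the scalar case\<close>

lemma MG_zero:
  assumes "G \<in> carrier_mat q q"
  shows "MG G (0\<^sub>v q) (0\<^sub>v q) = 1"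
proof -
  have "contingency_tables q (0\<^sub>v q) (0\<^sub>v q) = {0\<^sub>m q q}"
    by (auto simp: contingency_tables_def intro!: eq_matI)
  then show ?thesis
    using assms by (simp add: MG_table_weight table_weight_def vec_fact_def)
qed

text \<open>In terms of linear forms, \<open>MG H s t\<close> expands the forms of \<open>H\<close>
  in variables \<open>y\<close>, and \<open>MG G p s\<close> expands the result of substituting
  \<open>y = G z\<close>. The composite has forms \<open>H * G\<close>, hence the reversed order.
  The induction removes one unit from \<open>t\<close>.\<close>

lemma MG_mult:
  assumes G: "G \<in> carrier_mat q q" and H: "H \<in> carrier_mat q q"
    and "p \<in> V n q" "t \<in> V n q"
  shows "(\<Sum>s\<in>V n q. MG G p s * MG H s t) = MG (H * G) p t"
  using assms(3,4)
proof (induction n arbitrary: p t)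
  case 0
  then show ?case using G H by (simp add: V_0 MG_zero)
next
  case (Suc n)
  obtain a t' where t: "a < q" "t' \<in> V n q" "t = t' + unit_vec q a"
    using V_Suc_obtain[OF Suc.prems(2)] by blast
  \<comment> \<open>The condition on \<open>p\<close> in the recursion becomes a 0/1 factor, so that
    it can be moved through the sums.\<close>
  let ?P = "\<lambda>c. if p $ c = 0 then 0 else 1 :: complex"
  have HG: "(H * G) $$ (a, c) = (\<Sum>b<q. H $$ (a, b) * G $$ (b, c))" if "c < q" for c
    using that t G H by (auto simp: scalar_prod_def atLeast0LessThan)
  \<comment> \<open>The first recursion splits a factor of row \<open>a\<close> off
    \<open>H\<close>, which lowers \<open>s\<close> at \<open>b\<close>.\<close>
  have "(\<Sum>s\<in>V (Suc n) q. MG G p s * MG H s t)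
      = (\<Sum>s\<in>V (Suc n) q. \<Sum>b<q. if s $ b = 0 then 0
          else H $$ (a, b) * (MG G p s * MG H (s - unit_vec q b) t'))"
    unfolding t(3)
    by (intro sum.cong refl) (simp add: MG_add_unit_vec[OF H V_D(2) V_D(2)[OF t(2)] t(1)]
       sum_distrib_left if_distrib mult_ac cong: if_cong)
  also have "\<dots> = (\<Sum>b<q. \<Sum>s\<in>V (Suc n) q. if s $ b = 0 then 0
          else H $$ (a, b) * (MG G p s * MG H (s - unit_vec q b) t'))"
    by (rule sum.swap)
  also have "\<dots> = (\<Sum>b<q. \<Sum>s\<in>V n q. H $$ (a, b) * (MG G p (s + unit_vec q b) * MG H s t'))"
    by (rule sum.cong[OF refl], subst sum_V_Suc) (auto simp: diff_add_unit_vec V_D(2))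
  \<comment> \<open>After the shift of \<open>s\<close>, the unit at \<open>b\<close> sits in the
    second argument of \<open>MG G\<close>, so the recursion applies again, now to row
    \<open>b\<close> of \<open>G\<close>.\<close>
  also have "\<dots> = (\<Sum>b<q. \<Sum>s\<in>V n q. \<Sum>c<q. ?P c *
      (H $$ (a, b) * G $$ (b, c) * (MG G (p - unit_vec q c) s * MG H s t')))"
    by (intro sum.cong refl, simp add: MG_add_unit_vec[OF G V_D(2)[OF Suc.prems(1)] V_D(2)]
       sum_distrib_left sum_distrib_right, intro sum.cong refl, auto)
  also have "\<dots> = (\<Sum>b<q. \<Sum>c<q. \<Sum>s\<in>V n q. ?P c *
      (H $$ (a, b) * G $$ (b, c) * (MG G (p - unit_vec q c) s * MG H s t')))"
    by (intro sum.cong refl sum.swap)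
  also have "\<dots> = (\<Sum>c<q. \<Sum>b<q. \<Sum>s\<in>V n q. ?P c *
      (H $$ (a, b) * G $$ (b, c) * (MG G (p - unit_vec q c) s * MG H s t')))"
    by (rule sum.swap)
  \<comment> \<open>For fixed \<open>c\<close> the sum factors: the part over \<open>b\<close> is an
    entry of \<open>H * G\<close>, and the part over \<open>s\<close> is the induction
    hypothesis.\<close>
  also have "\<dots> = (\<Sum>c<q. ?P c * ((\<Sum>b<q. H $$ (a, b) * G $$ (b, c)) *
      (\<Sum>s\<in>V n q. MG G (p - unit_vec q c) s * MG H s t')))"
    unfolding sum_product by (simp only: sum_distrib_left)
  also have "\<dots> = (\<Sum>c<q. if p $ c = 0 then 0 else (H * G) $$ (a, c) * MG (H * G) (p - unit_vec q c) t')"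
    using Suc.IH diff_unit_vec_in_V[OF Suc.prems(1)] t
    by (intro sum.cong refl) (auto simp: HG simp del: index_mult_mat)
  also have "\<dots> = MG (H * G) p t"
    unfolding t(3) using G H
    by (subst MG_add_unit_vec[OF _ V_D(2)[OF Suc.prems(1)] V_D(2)[OF t(2)] t(1)]) auto
  finally show ?case .
qed

text \<open>Row \<open>a\<close> of a scalar matrix has one possibly nonzero entry, so each step of
  the recursion removes a unit at the same position from \<open>p\<close> and \<open>t\<close> and
  contributes one factor \<open>c\<close>.\<close>

lemma MG_scalar:
  assumes "p \<in> V n q" "t \<in> V n q"
  shows "MG (c \<cdot>\<^sub>m 1\<^sub>m q) p t = (if p = t then c ^ n else 0)"
  using assms
proof (induction n arbitrary: p t)
  case 0
  then show ?case by (simp add: V_0 MG_zero)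
next
  case (Suc n)
  obtain a t' where t: "a < q" "t' \<in> V n q" "t = t' + unit_vec q a"
    using V_Suc_obtain[OF Suc.prems(2)] by blast
  have "MG (c \<cdot>\<^sub>m 1\<^sub>m q) p t = (\<Sum>b<q. if p $ b = 0 then 0
      else (c \<cdot>\<^sub>m 1\<^sub>m q) $$ (a, b) * MG (c \<cdot>\<^sub>m 1\<^sub>m q) (p - unit_vec q b) t')"
    unfolding t(3)
    by (intro MG_add_unit_vec V_D(2)[OF Suc.prems(1)] V_D(2)[OF t(2)] t(1)) simp
  also have "\<dots> = (\<Sum>b<q. if b = a then
      (if p $ a = 0 then 0 else c * MG (c \<cdot>\<^sub>m 1\<^sub>m q) (p - unit_vec q a) t') else 0)"
    using t by (intro sum.cong) auto
  also have "\<dots> = (if p $ a = 0 then 0 else c * MG (c \<cdot>\<^sub>m 1\<^sub>m q) (p - unit_vec q a) t')"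
    using t by simp
  also have "\<dots> = (if p = t then c ^ Suc n else 0)"
  proof (cases "p $ a = 0")
    case True
    then have "p \<noteq> t" using t V_D(2)[OF t(2)] by auto
    then show ?thesis using True by simp
  next
    case False
    \<comment> \<open>Since \<open>p $ a\<close> is positive, removing the unit at \<open>a\<close>
      is reversible.\<close>
    have "p - unit_vec q a = t' \<longleftrightarrow> p = t"
      using False add_diff_unit_vec[OF V_D(2)[OF Suc.prems(1)] t(1)]
        diff_add_unit_vec[OF V_D(2)[OF t(2)] t(1)] t(3)
      by auto
    then show ?thesis
      using False Suc.IH[OF diff_unit_vec_in_V[OF Suc.prems(1) t(1)] t(2)] by auto
  qed
  finally show ?case .
qed

section \<open>Conjugation and scaling of rows and columns\<close>

lemma MG_conj:
  assumes "G \<in> carrier_mat q q"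
  shows "MG (map_mat cnj G) p s = cnj (MG G p s)"
proof -
  have "cnj (fact k) = (fact k :: complex)" for k
    by (metis complex_cnj_of_nat of_nat_fact)
  then show ?thesis using assms by (simp add: MG_def)
qed

text \<open>Over a table, the exponents of \<open>d a\<close> add up to the row sum
  \<open>s $ a\<close> and those of \<open>e b\<close> to the column sum \<open>p $ b\<close>. These
  are the same for all tables, so the scaling leaves the sum.\<close>

lemma MG_scale_rows_cols:
  assumes "G \<in> carrier_mat q q" "K \<in> carrier_mat q q"
    and "\<And>a b. a < q \<Longrightarrow> b < q \<Longrightarrow> K $$ (a, b) = d a * e b * G $$ (a, b)"
  shows "MG K p s = (\<Prod>a<q. d a ^ (s $ a)) * (\<Prod>b<q. e b ^ (p $ b)) * MG G p s"
proof -
  have "table_weight K r = (\<Prod>a<q. d a ^ (s $ a)) * (\<Prod>b<q. e b ^ (p $ b)) * table_weight G r"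
    if r: "r \<in> contingency_tables q p s" for r
  proof -
    have "table_weight K r = (\<Prod>a<q. \<Prod>b<q. d a ^ (r $$ (a, b))) * (\<Prod>a<q. \<Prod>b<q. e b ^ (r $$ (a, b)))
        * table_weight G r"
      using assms
      by (simp add: table_weight_def prod.distrib[symmetric] power_mult_distrib mult.assoc)
    also have "(\<Prod>a<q. \<Prod>b<q. d a ^ (r $$ (a, b))) = (\<Prod>a<q. d a ^ (s $ a))"
      using r by (intro prod.cong refl) (auto simp: contingency_tables_def power_sum[symmetric])
    also have "(\<Prod>a<q. \<Prod>b<q. e b ^ (r $$ (a, b))) = (\<Prod>b<q. e b ^ (p $ b))"
      using r by (subst prod.swap, intro prod.cong refl) (auto simp: contingency_tables_def power_sum[symmetric])
    finally show ?thesis .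
  qed
  then show ?thesis
    using assms by (simp add: MG_table_weight sum_distrib_left mult_ac)
qed

lemma MG_sign_change:
  assumes "q > 0" "G \<in> carrier_mat q q" "K \<in> carrier_mat q q"
    and "\<And>a b. a < q \<Longrightarrow> b < q \<Longrightarrow> K $$ (a, b) = (if a = 0 \<longleftrightarrow> b = 0 then G $$ (a, b) else - G $$ (a, b))"
  shows "MG K p s = (-1) ^ (s $ 0) * (-1) ^ (p $ 0) * MG G p s"
proof -
  \<comment> \<open>Used for rows and columns alike, this flips the sign of row 0 and of column 0;
    the corner is flipped twice and stays.\<close>
  define d :: "nat \<Rightarrow> complex" where "d a = (if a = 0 then -1 else 1)" for a
  have "(\<Prod>a<q. d a ^ (v $ a)) = (\<Prod>a<q. if a = 0 then (-1) ^ (v $ 0) else 1)" for v :: "nat vec"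
    by (intro prod.cong) (auto simp: d_def)
  then have "(\<Prod>a<q. d a ^ (v $ a)) = (-1) ^ (v $ 0)" for v :: "nat vec"
    using assms(1) by simp
  moreover have "MG K p s = (\<Prod>a<q. d a ^ (s $ a)) * (\<Prod>b<q. d b ^ (p $ b)) * MG G p s"
    using assms by (intro MG_scale_rows_cols) (auto simp: d_def)
  ultimately show ?thesis by simp
qed

section \<open>Orthogonality and inversion of expansions\<close>

lemma MG_orthogonality:
  assumes "G \<in> carrier_mat q q" "H \<in> carrier_mat q q" "H * G = c \<cdot>\<^sub>m 1\<^sub>m q"
    and "p \<in> V n q" "t \<in> V n q"
  shows "(\<Sum>s\<in>V n q. MG G p s * MG H s t) = (if p = t then c ^ n else 0)"
  using MG_mult[OF assms(1,2,4,5)] MG_scalar[OF assms(4,5)] assms(3) by simp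

text \<open>Applying a left inverse of the kernel \<open>M\<close>, up to the factor
  \<open>c\<close>, isolates one coefficient. The kernels are abstract so that both expansions are
  covered, the second with its arguments exchanged.\<close>

lemma expansion_inverse:
  fixes c :: "'a::field"
  assumes "finite A" "c \<noteq> 0" "l \<in> A"
    and orth: "\<And>s. s \<in> A \<Longrightarrow> (\<Sum>i\<in>A. L l i * M i s) = (if l = s then c else 0)"
    and exp: "\<And>x. x \<in> A \<Longrightarrow> f x = (\<Sum>s\<in>A. \<alpha> s * M x s)"
  shows "\<alpha> l = inverse c * (\<Sum>i\<in>A. f i * L l i)"
proof -
  have "(\<Sum>i\<in>A. f i * L l i) = (\<Sum>i\<in>A. \<Sum>s\<in>A. \<alpha> s * (L l i * M i s))"
    by (intro sum.cong refl) (simp add: exp sum_distrib_left mult_ac)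
  also have "\<dots> = (\<Sum>s\<in>A. \<alpha> s * (\<Sum>i\<in>A. L l i * M i s))"
    by (subst sum.swap) (simp add: sum_distrib_left)
  also have "\<dots> = (\<Sum>s\<in>A. if l = s then \<alpha> s * c else 0)"
    by (intro sum.cong) (auto simp: orth)
  also have "\<dots> = \<alpha> l * c" using assms by simp
  finally show ?thesis using assms by simp
qed

text \<open>The definition provides \<open>G * K\<close>. After division by \<open>q\<close>,
  \<open>K\<close> is a right inverse of a square matrix and therefore a left inverse, which gives
  \<open>K * G\<close>.\<close>

lemma generalized_hadamard_adjoint:
  assumes "q > 0" "generalized_hadamard q G"
  defines "K \<equiv> transpose_mat (map_mat cnj G)"
  shows "G \<in> carrier_mat q q" "K \<in> carrier_mat q q"
    "G * K = of_nat q \<cdot>\<^sub>m 1\<^sub>m q" "K * G = of_nat q \<cdot>\<^sub>m 1\<^sub>m q"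
proof -
  show G: "G \<in> carrier_mat q q" and GK: "G * K = of_nat q \<cdot>\<^sub>m 1\<^sub>m q"
    using assms by (auto simp: generalized_hadamard_def)
  show K: "K \<in> carrier_mat q q" using G by (simp add: K_def)
  let ?c = "inverse (of_nat q) :: complex"
  have scale: "?c \<cdot>\<^sub>m (of_nat q \<cdot>\<^sub>m A) = A" "of_nat q \<cdot>\<^sub>m (?c \<cdot>\<^sub>m A) = A" for A
    using assms(1) by (auto intro!: eq_matI)
  have "G * (?c \<cdot>\<^sub>m K) = 1\<^sub>m q"
    by (simp add: mult_smult_distrib[OF G K] GK scale)
  then have "(?c \<cdot>\<^sub>m K) * G = 1\<^sub>m q"
    using mat_mult_left_right_inverse[of G q "?c \<cdot>\<^sub>m K"] G K by simp
  then show "K * G = of_nat q \<cdot>\<^sub>m 1\<^sub>m q"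
    using scale(2)[of "K * G"] by (simp add: mult_smult_assoc_mat[OF K G])
qed

text \<open>Both coefficient formulas hold with the array of the adjoint \<open>K\<close>; symmetry
  serves afterwards to express \<open>MG K\<close> through \<open>MG G\<close>.\<close>

lemma generalized_hadamard_expansion:
  assumes "q > 0" "generalized_hadamard q G" "l \<in> V n q"
  defines "K \<equiv> transpose_mat (map_mat cnj G)"
  shows "(\<And>x. x \<in> V n q \<Longrightarrow> f x = (\<Sum>s\<in>V n q. \<alpha> s * MG G x s)) \<Longrightarrow>
      \<alpha> l = of_nat q powi (- int n) * (\<Sum>i\<in>V n q. f i * MG K l i)"
    and "(\<And>x. x \<in> V n q \<Longrightarrow> f x = (\<Sum>s\<in>V n q. \<beta> s * MG G s x)) \<Longrightarrow>
      \<beta> l = of_nat q powi (- int n) * (\<Sum>i\<in>V n q. f i * MG K i l)"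
proof -
  note K = generalized_hadamard_adjoint[OF assms(1,2), folded K_def]
  have c: "(of_nat q :: complex) ^ n \<noteq> 0" using assms(1) by simp
  have pow: "(of_nat q :: complex) powi (- int n) = inverse (of_nat q ^ n)"
    by (simp add: power_int_minus)
  \<comment> \<open>\<open>MG K\<close> stands to the left of \<open>MG G\<close> here, so by the
    reversed order the matrix product involved is \<open>G * K\<close>.\<close>
  show "\<alpha> l = of_nat q powi (- int n) * (\<Sum>i\<in>V n q. f i * MG K l i)"
    if "\<And>x. x \<in> V n q \<Longrightarrow> f x = (\<Sum>s\<in>V n q. \<alpha> s * MG G x s)"
    unfolding pow
    by (rule expansion_inverse[OF finite_V c assms(3), of _ "MG G"])
       (use MG_orthogonality[OF K(2,1,3) assms(3)] that in auto)
  \<comment> \<open>With both arrays transposed the order is the opposite one, and the product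
    involved is \<open>K * G\<close>.\<close>
  show "\<beta> l = of_nat q powi (- int n) * (\<Sum>i\<in>V n q. f i * MG K i l)"
    if "\<And>x. x \<in> V n q \<Longrightarrow> f x = (\<Sum>s\<in>V n q. \<beta> s * MG G s x)"
    unfolding pow
    by (rule expansion_inverse[OF finite_V c assms(3), of "\<lambda>a b. MG K b a" "\<lambda>a b. MG G b a"])
       (use MG_orthogonality[OF K(1,2,4) _ assms(3)] that in \<open>auto simp: mult.commute\<close>)
qed

section \<open>The adjoint under the two symmetry hypotheses\<close>

lemma symmetric_core_entry:
  assumes "symmetric_matrix (core G)" "G \<in> carrier_mat q q" "0 < a" "a < q" "0 < b" "b < q"
  shows "G $$ (b, a) = G $$ (a, b)"
proof -
  have "core G $$ (i, j) = G $$ (Suc i, Suc j)" if "i < q - 1" "j < q - 1" for i j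
    using that assms(2) by (simp add: core_def mat_delete_def)
  from this[of "b - 1" "a - 1"] this[of "a - 1" "b - 1"] assms
  have "G $$ (b, a) = core G $$ (b - 1, a - 1)" "G $$ (a, b) = core G $$ (a - 1, b - 1)" by auto
  moreover have "core G $$ (b - 1, a - 1) = transpose_mat (core G) $$ (a - 1, b - 1)"
    using assms by (subst index_transpose_mat) (auto simp: core_def mat_delete_def)
  ultimately show ?thesis using assms(1) by (simp add: symmetric_matrix_def)
qed

lemma MG_adjoint_symmetric:
  assumes "symmetric_matrix G" "G \<in> carrier_mat q q"
  shows "MG (transpose_mat (map_mat cnj G)) p s = cnj (MG G p s)"
proof -
  have "transpose_mat (map_mat cnj G) = map_mat cnj (transpose_mat G)" by auto
  then show ?thesis using assms by (simp add: symmetric_matrix_def MG_conj)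
qed

text \<open>Transposition exchanges the ones of row 0 with the entries -1 of column 0 and fixes the
  core and the corner. So the adjoint is the entrywise conjugate with signs flipped exactly where
  one of the two indices is 0.\<close>

lemma MG_adjoint_symmetric_core:
  assumes "q > 0" "G \<in> carrier_mat q q" "symmetric_matrix (core G)"
    and row: "\<And>j. j < q \<Longrightarrow> G $$ (0, j) = 1" and col: "\<And>i. 0 < i \<Longrightarrow> i < q \<Longrightarrow> G $$ (i, 0) = -1"
  shows "MG (transpose_mat (map_mat cnj G)) p s = (-1) ^ (s $ 0) * (-1) ^ (p $ 0) * cnj (MG G p s)"
proof -
  have twist: "transpose_mat (map_mat cnj G) $$ (a, b) = (if a = 0 \<longleftrightarrow> b = 0 then map_mat cnj G $$ (a, b)
      else - map_mat cnj G $$ (a, b))" if "a < q" "b < q" for a b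
    using that assms(1,2) symmetric_core_entry[OF assms(3,2), of a b] row col
    by (cases "a = 0"; cases "b = 0") auto
  show ?thesis
    unfolding MG_conj[OF assms(2), symmetric]
    by (rule MG_sign_change[OF assms(1) _ _ twist]) (use assms(2) in auto)
qed

theorem mainTheorem6:
  fixes q n :: nat and G :: "complex mat" and \<gamma> :: cmpoly
  assumes "q \<ge> 2"
    and "generalized_hadamard q G"
    and "poly_in_vars q \<gamma>"
  shows
    "(symmetric_matrix G \<longrightarrow>
        (\<forall>\<alpha> :: nat vec \<Rightarrow> complex.
           (\<forall>x\<in>V n q. eval_at \<gamma> x = (\<Sum>s\<in>V n q. \<alpha> s * MG G x s)) \<longrightarrow>
           (\<forall>l\<in>V n q. \<alpha> l =
              of_nat q powi (- int n) * (\<Sum>i\<in>V n q. eval_at \<gamma> i * cnj (MG G l i)))) \<and>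
        (\<forall>\<beta> :: nat vec \<Rightarrow> complex.
           (\<forall>x\<in>V n q. eval_at \<gamma> x = (\<Sum>s\<in>V n q. \<beta> s * MG G s x)) \<longrightarrow>
           (\<forall>l\<in>V n q. \<beta> l =
              of_nat q powi (- int n) * (\<Sum>i\<in>V n q. eval_at \<gamma> i * cnj (MG G i l))))) \<and>
     (symmetric_matrix (core G) \<and>
      (\<forall>j<q. G $$ (0, j) = 1) \<and> (\<forall>i\<in>{1..<q}. G $$ (i, 0) = -1) \<longrightarrow>
        (\<forall>\<alpha> :: nat vec \<Rightarrow> complex.
           (\<forall>x\<in>V n q. eval_at \<gamma> x = (\<Sum>s\<in>V n q. \<alpha> s * MG G x s)) \<longrightarrow>
           (\<forall>l\<in>V n q. \<alpha> l =
              (-1) ^ (l $ 0) * of_nat q powi (- int n) *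
                (\<Sum>i\<in>V n q. (-1) ^ (i $ 0) * eval_at \<gamma> i * cnj (MG G l i)))) \<and>
        (\<forall>\<beta> :: nat vec \<Rightarrow> complex.
           (\<forall>x\<in>V n q. eval_at \<gamma> x = (\<Sum>s\<in>V n q. \<beta> s * MG G s x)) \<longrightarrow>
           (\<forall>l\<in>V n q. \<beta> l =
              (-1) ^ (l $ 0) * of_nat q powi (- int n) *
                (\<Sum>i\<in>V n q. (-1) ^ (i $ 0) * eval_at \<gamma> i * cnj (MG G i l)))))"
proof -
  have q: "q > 0" using assms(1) by simp
  note G = generalized_hadamard_adjoint(1)[OF q assms(2)]
  note E = generalized_hadamard_expansion[OF q assms(2), where f = "eval_at \<gamma>"]
  show ?thesis
  proof (intro conjI impI allI ballI)
    fix \<alpha> l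
    assume sym: "symmetric_matrix G" and l: "l \<in> V n q"
      and exp: "\<forall>x\<in>V n q. eval_at \<gamma> x = (\<Sum>s\<in>V n q. \<alpha> s * MG G x s)"
    show "\<alpha> l = of_nat q powi (- int n) * (\<Sum>i\<in>V n q. eval_at \<gamma> i * cnj (MG G l i))"
      using E(1)[OF l bspec[OF exp]] by (simp add: MG_adjoint_symmetric[OF sym G])
  next
    fix \<beta> l
    assume sym: "symmetric_matrix G" and l: "l \<in> V n q"
      and exp: "\<forall>x\<in>V n q. eval_at \<gamma> x = (\<Sum>s\<in>V n q. \<beta> s * MG G s x)"
    show "\<beta> l = of_nat q powi (- int n) * (\<Sum>i\<in>V n q. eval_at \<gamma> i * cnj (MG G i l))"
      using E(2)[OF l bspec[OF exp]] by (simp add: MG_adjoint_symmetric[OF sym G])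
  next
    fix \<alpha> l
    assume "symmetric_matrix (core G) \<and>
      (\<forall>j<q. G $$ (0, j) = 1) \<and> (\<forall>i\<in>{1..<q}. G $$ (i, 0) = -1)" and l: "l \<in> V n q"
      and exp: "\<forall>x\<in>V n q. eval_at \<gamma> x = (\<Sum>s\<in>V n q. \<alpha> s * MG G x s)"
    then have K: "MG (transpose_mat (map_mat cnj G)) p s
        = (-1) ^ (s $ 0) * (-1) ^ (p $ 0) * cnj (MG G p s)" for p s
      by (intro MG_adjoint_symmetric_core[OF q G]) auto
    \<comment> \<open>\<open>K\<close> is used with \<open>p = l\<close> and \<open>s = i\<close>:
      the sign of \<open>i\<close> remains under the sum, and that of \<open>l\<close> is the outer
      factor.\<close>
    show "\<alpha> l = (-1) ^ (l $ 0) * of_nat q powi (- int n) *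
        (\<Sum>i\<in>V n q. (-1) ^ (i $ 0) * eval_at \<gamma> i * cnj (MG G l i))"
      using E(1)[OF l bspec[OF exp]] by (simp only: K sum_distrib_left mult_ac)
  next
    fix \<beta> l
    assume "symmetric_matrix (core G) \<and>
      (\<forall>j<q. G $$ (0, j) = 1) \<and> (\<forall>i\<in>{1..<q}. G $$ (i, 0) = -1)" and l: "l \<in> V n q"
      and exp: "\<forall>x\<in>V n q. eval_at \<gamma> x = (\<Sum>s\<in>V n q. \<beta> s * MG G s x)"
    then have K: "MG (transpose_mat (map_mat cnj G)) p s
        = (-1) ^ (s $ 0) * (-1) ^ (p $ 0) * cnj (MG G p s)" for p s
      by (intro MG_adjoint_symmetric_core[OF q G]) auto
    \<comment> \<open>The roles of \<open>i\<close> and \<open>l\<close> in \<open>K\<close> are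
      exchanged, but the product of the two signs is symmetric in them.\<close>
    show "\<beta> l = (-1) ^ (l $ 0) * of_nat q powi (- int n) *
        (\<Sum>i\<in>V n q. (-1) ^ (i $ 0) * eval_at \<gamma> i * cnj (MG G i l))"
      using E(2)[OF l bspec[OF exp]] by (simp only: K sum_distrib_left mult_ac)
  qed
qed

end
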